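(* Let $\mathcal{G}=\{G_1,\dots,G_s\}$ be a set of real $n\times n$ matrices, $c\in\mathbb{R}^n$, and $A\in\mathbb{R}^{m\times n}$ with $i$-th row $a_i^T$. Suppose $\rho(\mathcal{G})<1$ and the set $P=\{x\in\mathbb{R}^n\mid Ax\le1\}$ is bounded. Let $l\ge 1$ be the smallest integer for which there exist matrices $H_\pi\in S^{n\times n}$, $\pi\in\{1,\dots,s\}^{l-1}$, with $$H_\pi\succ0\ \ \forall\pi\in\{1,\dots,s\}^{l-1},\qquad G_j^TH_{i\sigma}G_j\preceq H_{\sigma j}\ \ \forall\sigma\in\{1,\dots,s\}^{l-2},\ \forall i,j\in\{1,\dots,s\}.$$ For each integer $r\ge0$ consider the problem $(\mathrm{N}_r)$: minimize $c^Tx$ over $x\in\mathbb{R}^n$ and $H_\pi\in S^{n\times n}$, $\pi\in\{1,\dots,s\}^{l-1}$, subject to - $H_\pi\succ0$ for all $\pi\in\{1,\dots,s\}^{l-1}$, - $G_j^TH_{i\sigma}G_j\preceq H_{\sigma j}$ for all $\sigma\in\{1,\dots,s\}^{l-2}$, $i,j\in\{1,\dots,s\}$, - for all $z\in\mathbb{R}^n$: $z^TH_{1\ldots1}z\le1\Rightarrow Az\le1$, - $(Gx)^TH_\pi(Gx)\le1$ for all $\pi\in\{1,\dots,s\}^{l-1}$ and $G\in\mathcal{G}^r$, - $AGx\le1$ for all $G\in\bigcup_{k=0}^{r-1}\mathcal{G}^k$; and the semidefinite program $(\mathrm{SDP}_r)$: minimize $c^Tx$ over $x\in\mathbb{R}^n$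 and $Q_\pi\in S^{n\times n}$, $\pi\in\{1,\dots,s\}^{l-1}$, subject to - $Q_\pi\succ0$ for all $\pi\in\{1,\dots,s\}^{l-1}$, - $G_jQ_{\sigma j}G_j^T\preceq Q_{i\sigma}$ for all $\sigma\in\{1,\dots,s\}^{l-2}$, $i,j\in\{1,\dots,s\}$, - $a_j^TQ_{1\ldots1}a_j\le1$ for all $j\in\{1,\dots,m\}$, - $\begin{pmatrix}Q_\pi & Gx\\ (Gx)^T&1\end{pmatrix}\succeq0$ for all $G\in\mathcal{G}^r$ and $\pi\in\{1,\dots,s\}^{l-1}$, - $AGx\le1$ for all $G\in\bigcup_{k=0}^{r-1}\mathcal{G}^k$. Then: (i) The optimal values of $(\mathrm{N}_r)$ and $(\mathrm{SDP}_r)$ are the same, the optimal vectors $x_r$ in the two problems are the same, and the optimal matrices $H_{\pi,r}$ and $Q_{\pi,r}$ are related via $Q_{\pi,r}=H_{\pi,r}^{-1}$. (ii) The optimal values of $(\mathrm{SDP}_r)$ provide upper bounds on the optimal value of the R-UTVLD-LP $\min\{c^Tx : Gx\in P\ \ \forall G\in\mathcal{G}^*\}$, are nonincreasing with $r$, and reach the optimal value of the R-UTVLD-LP in a finite number of steps $\bar r$. Moreover, any optimal solution $x_r$ to $(\mathrm{SDP}_r)$ with $r\ge\bar r$ is an optimal solution to the R-UTVLD-LP.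
   Context: $S^{n\times n}$ is the set of real symmetric $n\times n$ matrices; $\succ,\succeq,\preceq$ refer to the positive (semi)definite order; $Ax\le1$ means each entry of $Ax$ is at most $1$. $\mathcal{G}^k$ is the set of all products of length $k$ of matrices from $\mathcal{G}$ ($\mathcal{G}^0=\{I\}$), and $\mathcal{G}^*=\bigcup_{k=0}^\infty\mathcal{G}^k$. The joint spectral radius is $\rho(\mathcal{G}):=\lim_{k\to\infty}\max_{\sigma\in\{1,\dots,s\}^k}\|G_{\sigma_1}\cdots G_{\sigma_k}\|^{1/k}$; it is known that when $\rho(\mathcal{G})<1$ an integer $l$ as in the claim exists. R-UTVLD-LP stands for robust to uncertain and time-varying linear dynamics linear program. Multi-index conventions: $i\sigma$ and $\sigma j$ denote concatenation, and $1\ldots1$ is the multi-index of length $l-1$ with all entries $1$. When $l=1$ there is a single matrix $H$ (resp. $Q$), which also plays the role of $H_{1\ldots1}$ (resp. $Q_{1\ldots 1}$), and the second family of constraints reads $G_j^THG_j\preceq H$ (resp. $G_jQG_j^T\preceq Q$) for all $j$. When $l=2$ the matrices are $H_1,\dots,H_s$ (resp. $Q_1,\dots,Q_s$) and the second family reads $G_j^TH_iG_j\preceq H_j$ (resp. $G_jQ_jG_j^T\preceq Q_i$) for all $i,j$. When $r=0$ the constraints indexed by $\bigcup_{k=0}^{r-1}\mathcal{G}^k$ are absent. *)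

theory Defs
  imports "HOL-Analysis.Analysis"
begin

definition sym_matrix :: "real^'n^'n \<Rightarrow> bool" where
  "sym_matrix M \<longleftrightarrow> transpose M = M"

definition pos_def :: "real^'n^'n \<Rightarrow> bool" where
  "pos_def M \<longleftrightarrow> sym_matrix M \<and> (\<forall>x. x \<noteq> 0 \<longrightarrow> x \<bullet> (M *v x) > 0)"

definition pos_semidef :: "real^'n^'n \<Rightarrow> bool" where
  "pos_semidef M \<longleftrightarrow> sym_matrix M \<and> (\<forall>x. x \<bullet> (M *v x) \<ge> 0)"

definition loewner_le :: "real^'n^'n \<Rightarrow> real^'n^'n \<Rightarrow> bool"  (infix "\<preceq>" 50) where
  "M \<preceq> N \<longleftrightarrow> pos_semidef (N - M)"

text \<open>The block matrix with rows \<open>(Q, y)\<close> and \<open>(y\<^sup>T, 1)\<close>; the type \<open>unit\<close> indexes the last row and column.\<close>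

definition bordered :: "real^'n^'n \<Rightarrow> real^'n \<Rightarrow> real^('n + unit)^('n + unit)" where
  "bordered Q y = (\<chi> i j. case i of
      Inl i' \<Rightarrow> (case j of Inl j' \<Rightarrow> Q $ i' $ j' | Inr _ \<Rightarrow> y $ i')
    | Inr _ \<Rightarrow> (case j of Inl j' \<Rightarrow> y $ j' | Inr _ \<Rightarrow> 1))"

definition words :: "nat \<Rightarrow> nat \<Rightarrow> nat list set" where
  "words s k = {\<sigma>. length \<sigma> = k \<and> set \<sigma> \<subseteq> {1..s}}"

definition mat_prod :: "(real^'n^'n) list \<Rightarrow> real^'n^'n" where
  "mat_prod Ms = foldr (**) Ms (mat 1)"

definition products :: "(real^'n^'n) set \<Rightarrow> nat \<Rightarrow> (real^'n^'n) set" where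
  "products \<G> k = {mat_prod Ms | Ms. length Ms = k \<and> set Ms \<subseteq> \<G>}"

definition all_products :: "(real^'n^'n) set \<Rightarrow> (real^'n^'n) set" where
  "all_products \<G> = (\<Union>k. products \<G> k)"

text \<open>Joint spectral radius of \<open>G 1, \<dots>, G s\<close>, with the spectral norm as the matrix norm
  (the limit is the same for every norm).  The term for \<open>k = 0\<close> is a junk value, as
  \<open>root 0 x = 0\<close>.\<close>

definition joint_spectral_radius :: "nat \<Rightarrow> (nat \<Rightarrow> real^'n^'n) \<Rightarrow> real" where
  "joint_spectral_radius s G =
     lim (\<lambda>k. Max ((\<lambda>\<sigma>. root k (onorm ((*v) (mat_prod (map G \<sigma>))))) ` words s k))"

text \<open>A family of matrices indexed by the multi-indices in \<open>words s (l - 1)\<close> is a function on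
  lists; its values at other lists are irrelevant.  For \<open>l = 1\<close> the only index is \<open>[]\<close>.\<close>

definition lyap_family ::
  "nat \<Rightarrow> (nat \<Rightarrow> real^'n^'n) \<Rightarrow> nat \<Rightarrow> (nat list \<Rightarrow> real^'n^'n) \<Rightarrow> bool" where
  "lyap_family s G l H \<longleftrightarrow>
     (\<forall>\<pi>\<in>words s (l - 1). pos_def (H \<pi>)) \<and>
     (if l = 1
      then \<forall>j\<in>{1..s}. transpose (G j) ** H [] ** G j \<preceq> H []
      else \<forall>\<sigma>\<in>words s (l - 2). \<forall>i\<in>{1..s}. \<forall>j\<in>{1..s}.
             transpose (G j) ** H (i # \<sigma>) ** G j \<preceq> H (\<sigma> @ [j]))"

definition dual_lyap_family ::
  "nat \<Rightarrow> (nat \<Rightarrow> real^'n^'n) \<Rightarrow> nat \<Rightarrow> (nat list \<Rightarrow> real^'n^'n) \<Rightarrow> bool" where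
  "dual_lyap_family s G l Q \<longleftrightarrow>
     (\<forall>\<pi>\<in>words s (l - 1). pos_def (Q \<pi>)) \<and>
     (if l = 1
      then \<forall>j\<in>{1..s}. G j ** Q [] ** transpose (G j) \<preceq> Q []
      else \<forall>\<sigma>\<in>words s (l - 2). \<forall>i\<in>{1..s}. \<forall>j\<in>{1..s}.
             G j ** Q (\<sigma> @ [j]) ** transpose (G j) \<preceq> Q (i # \<sigma>))"

text \<open>Below, inequalities between vectors are componentwise, and \<open>1 :: real^'m\<close> is the all-ones
  vector.\<close>

definition N_feasible :: "nat \<Rightarrow> (nat \<Rightarrow> real^'n^'n) \<Rightarrow> real^'n^'m \<Rightarrow> nat \<Rightarrow> nat \<Rightarrow>
    (real^'n) \<times> (nat list \<Rightarrow> real^'n^'n) \<Rightarrow> bool" where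
  "N_feasible s G A l r = (\<lambda>(x, H).
     lyap_family s G l H \<and>
     (\<forall>z. z \<bullet> (H (replicate (l - 1) 1) *v z) \<le> 1 \<longrightarrow> A *v z \<le> 1) \<and>
     (\<forall>\<pi>\<in>words s (l - 1). \<forall>M\<in>products (G ` {1..s}) r.
        (M *v x) \<bullet> (H \<pi> *v (M *v x)) \<le> 1) \<and>
     (\<forall>M\<in>(\<Union>k<r. products (G ` {1..s}) k). A *v (M *v x) \<le> 1))"

definition SDP_feasible :: "nat \<Rightarrow> (nat \<Rightarrow> real^'n^'n) \<Rightarrow> real^'n^'m \<Rightarrow> nat \<Rightarrow> nat \<Rightarrow>
    (real^'n) \<times> (nat list \<Rightarrow> real^'n^'n) \<Rightarrow> bool" where
  "SDP_feasible s G A l r = (\<lambda>(x, Q).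
     dual_lyap_family s G l Q \<and>
     (\<forall>j. row j A \<bullet> (Q (replicate (l - 1) 1) *v row j A) \<le> 1) \<and>
     (\<forall>M\<in>products (G ` {1..s}) r. \<forall>\<pi>\<in>words s (l - 1).
        pos_semidef (bordered (Q \<pi>) (M *v x))) \<and>
     (\<forall>M\<in>(\<Union>k<r. products (G ` {1..s}) k). A *v (M *v x) \<le> 1))"

definition RUTVLD_feasible :: "nat \<Rightarrow> (nat \<Rightarrow> real^'n^'n) \<Rightarrow> real^'n^'m \<Rightarrow> real^'n \<Rightarrow> bool" where
  "RUTVLD_feasible s G A x \<longleftrightarrow>
     (\<forall>M\<in>all_products (G ` {1..s}). M *v x \<in> {y. A *v y \<le> 1})"

text \<open>Optimal values are extended reals, so that they exist whether or not they are attained.\<close>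

definition opt_value :: "('v \<Rightarrow> real) \<Rightarrow> ('v \<Rightarrow> bool) \<Rightarrow> ereal" where
  "opt_value f P = (INF v\<in>{v. P v}. ereal (f v))"

definition obj :: "real^'n \<Rightarrow> (real^'n) \<times> (nat list \<Rightarrow> real^'n^'n) \<Rightarrow> real" where
  "obj c = (\<lambda>(x, H). c \<bullet> x)"

end

theory Submission
  imports Defs
begin

text \<open>
  \<^bold>\<open>Equivalence of the two problems.\<close>  For positive definite \<open>H\<close> the inequality
  \<open>2 u \<bullet> v \<le> u \<bullet> H u + v \<bullet> H\<^sup>-\<^sup>1 v\<close>, which is an equality at \<open>u = H\<^sup>-\<^sup>1 v\<close>, expresses that the quadratic
  forms of \<open>H\<close> and \<open>H\<^sup>-\<^sup>1\<close> are conjugate to each other.  It yields, one constraint at a time, that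
  inverting all the matrices of the family turns one problem into the other: it reverses the
  Lyapunov inequalities (\<open>lyapunov_inverse\<close>), it turns containment of an ellipsoid in a
  half-space into a bound on the inverse form (\<open>ellipsoid_in_halfspace_iff\<close>), and it identifies
  semidefiniteness of the bordered matrix with membership in an ellipsoid
  (\<open>pos_semidef_bordered_iff\<close>).  The vector \<open>x\<close> is untouched, so values and minimizers agree.

  \<^bold>\<open>Upper bounds and monotonicity.\<close>  The Lyapunov inequalities say that the intersection \<open>E\<close> of
  all the ellipsoids \<open>{y. y \<bullet> H\<^sub>\<pi> y \<le> 1}\<close> is mapped into itself by every \<open>G\<^sub>j\<close>.  If \<open>(x, H)\<close> is
  feasible at level \<open>r\<close>, then all products of length \<open>r\<close> send \<open>x\<close> into \<open>E\<close>, hence so do all longer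
  ones; as \<open>E\<close> lies in the polytope, \<open>x\<close> is feasible for the robust program, and \<open>(x, H)\<close>
  is feasible at level \<open>r + 1\<close>.

  \<^bold>\<open>Finite convergence.\<close>  Rescaling a Lyapunov family by a large factor puts the ellipsoid of
  the index \<open>1\<dots>1\<close>, and hence \<open>E\<close>, inside the polytope.
  Since the joint spectral radius is less than \<open>1\<close>, the norms of the products of length
  \<open>r\<close> tend to \<open>0\<close> uniformly, and the feasible set of the robust program is bounded, being
  contained in the polytope.  So for one large \<open>r\<close> \<^emph>\<open>every\<close> feasible point of the robust
  program is moved into the rescaled \<open>E\<close>, and both feasible sets have the same \<open>x\<close>-part
  (\<open>finite_convergence\<close>).  Because the joint spectral radius is a limit, uniform decay can be
  read off from it only once the limit is known to exist; this is Fekete's lemma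
  (\<open>fekete_root_convergent\<close>).
\<close>

section \<open>Quadratic forms and inverses\<close>

lemma inner_transpose_mult:
  fixes B :: "real^'n^'m"
  shows "x \<bullet> (transpose B *v y) = (B *v x) \<bullet> y"
  by (metis dot_lmul_matrix inner_commute transpose_matrix_vector)

lemma sym_inner:
  assumes "sym_matrix M"
  shows "x \<bullet> (M *v y) = (M *v x) \<bullet> y"
  using assms inner_transpose_mult[of x M y] by (simp add: sym_matrix_def)

lemma inner_congruence:
  fixes B :: "real^'n^'n"
  shows "x \<bullet> ((transpose B ** H ** B) *v x) = (B *v x) \<bullet> (H *v (B *v x))"
  by (metis inner_transpose_mult matrix_vector_mul_assoc)

lemma sym_congruence:
  "sym_matrix H \<Longrightarrow> sym_matrix (transpose B ** H ** B)"
  by (simp add: sym_matrix_def matrix_transpose_mul matrix_mul_assoc)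

lemma loewner_le_iff:
  assumes "sym_matrix M" "sym_matrix N"
  shows "M \<preceq> N \<longleftrightarrow> (\<forall>x. x \<bullet> (M *v x) \<le> x \<bullet> (N *v x))"
proof -
  have "sym_matrix (N - M)"
    using assms by (simp add: sym_matrix_def transpose_def vec_eq_iff)
  then show ?thesis
    by (simp add: loewner_le_def pos_semidef_def matrix_vector_mult_diff_rdistrib inner_diff_right)
qed

lemma pos_def_sym: "pos_def H \<Longrightarrow> sym_matrix H"
  by (simp add: pos_def_def)

lemma pos_def_nonneg: "pos_def H \<Longrightarrow> 0 \<le> x \<bullet> (H *v x)"
  by (cases "x = 0") (auto simp: pos_def_def less_imp_le)

lemma pos_def_invertible:
  assumes "pos_def H"
  shows "invertible H"
proof -
  have "x = 0" if "H *v x = 0" for x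
    using assms that unfolding pos_def_def by (metis inner_zero_right less_irrefl)
  then show ?thesis
    by (metis invertible_left_inverse matrix_left_invertible_ker)
qed

lemma matrix_inv_inverse:
  assumes "invertible (H :: real^'n^'n)"
  shows "H ** matrix_inv H = mat 1" "matrix_inv H ** H = mat 1"
  using assms someI_ex[of "\<lambda>A'. H ** A' = mat 1 \<and> A' ** H = mat 1"]
  unfolding invertible_def matrix_inv_def by auto

lemma pos_def_inv_cancel:
  assumes "pos_def H"
  shows "H *v (matrix_inv H *v x) = x" "matrix_inv H *v (H *v x) = x"
  using matrix_inv_inverse[OF pos_def_invertible[OF assms]]
  by (simp_all add: matrix_vector_mul_assoc)

lemma pos_def_matrix_inv:
  assumes "pos_def H"
  shows "pos_def (matrix_inv H)"
  unfolding pos_def_def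
proof (intro conjI allI impI)
  note inv = matrix_inv_inverse[OF pos_def_invertible[OF assms]]
  have "transpose (matrix_inv H) ** H = mat 1"
    using inv(1) pos_def_sym[OF assms]
    by (metis matrix_transpose_mul sym_matrix_def transpose_mat)
  then show "sym_matrix (matrix_inv H)"
    unfolding sym_matrix_def by (metis inv(1) matrix_mul_assoc matrix_mul_lid matrix_mul_rid)
next
  fix x :: "real^'a"
  assume "x \<noteq> 0"
  let ?y = "matrix_inv H *v x"
  have "?y \<noteq> 0"
    using \<open>x \<noteq> 0\<close> pos_def_inv_cancel(1)[OF assms, of x] by auto
  then have "0 < ?y \<bullet> (H *v ?y)"
    using assms by (simp add: pos_def_def)
  then show "0 < x \<bullet> (matrix_inv H *v x)"
    by (simp add: pos_def_inv_cancel[OF assms] inner_commute)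
qed

lemma matrix_inv_matrix_inv:
  assumes "pos_def H"
  shows "matrix_inv (matrix_inv H) = H"
proof -
  note inv = matrix_inv_inverse[OF pos_def_invertible[OF assms]]
  note inv' = matrix_inv_inverse[OF pos_def_invertible[OF pos_def_matrix_inv[OF assms]]]
  show ?thesis
    by (metis inv(1) inv'(1) matrix_mul_assoc matrix_mul_lid matrix_mul_rid)
qed

text \<open>Fenchel's inequality for the conjugate pair \<open>H\<close>, \<open>H\<^sup>-\<^sup>1\<close>: expand the form of \<open>H\<close> at
  \<open>u - H\<^sup>-\<^sup>1 v\<close>.\<close>

lemma two_inner_le_quadratic_forms:
  assumes "pos_def H"
  shows "2 * (u \<bullet> v) \<le> u \<bullet> (H *v u) + v \<bullet> (matrix_inv H *v v)"
proof -
  let ?w = "matrix_inv H *v v"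
  have "0 \<le> (u - ?w) \<bullet> (H *v (u - ?w))"
    by (rule pos_def_nonneg[OF assms])
  also have "\<dots> = u \<bullet> (H *v u) - u \<bullet> v - ?w \<bullet> (H *v u) + ?w \<bullet> v"
    by (simp add: matrix_vector_mult_diff_distrib pos_def_inv_cancel[OF assms]
        inner_diff_left inner_diff_right)
  also have "?w \<bullet> (H *v u) = u \<bullet> v"
    by (metis sym_inner[OF pos_def_sym[OF assms]] pos_def_inv_cancel(1)[OF assms] inner_commute)
  finally show ?thesis
    by (simp add: inner_commute)
qed

text \<open>Inversion reverses a Lyapunov inequality.  Conjugating \<open>f \<circ> B \<le> g\<close> gives
  \<open>g\<^sup>* \<circ> B\<^sup>T \<le> f\<^sup>*\<close>; concretely, \<open>w = K\<^sup>-\<^sup>1 B\<^sup>T u\<close> attains the supremum defining the conjugate of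
  the form of \<open>K\<close> at \<open>B\<^sup>T u\<close>.\<close>

lemma lyapunov_inverse:
  fixes B H K :: "real^'n^'n"
  assumes H: "pos_def H" and K: "pos_def K"
    and le: "transpose B ** H ** B \<preceq> K"
  shows "B ** matrix_inv K ** transpose B \<preceq> matrix_inv H"
proof -
  have form: "u \<bullet> ((B ** matrix_inv K ** transpose B) *v u)
      \<le> u \<bullet> (matrix_inv H *v u)" for u
  proof -
    let ?w = "matrix_inv K *v (transpose B *v u)"
    let ?p = "u \<bullet> ((B ** matrix_inv K ** transpose B) *v u)"
    have p: "?p = u \<bullet> (B *v ?w)"
      by (simp add: matrix_vector_mul_assoc matrix_mul_assoc del: transpose_matrix_vector)
    have "?w \<bullet> (K *v ?w) = ?p"
      unfolding p pos_def_inv_cancel(1)[OF K] inner_transpose_mult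
      by (simp add: inner_commute)
    moreover have "(B *v ?w) \<bullet> (H *v (B *v ?w)) \<le> ?w \<bullet> (K *v ?w)"
      using le unfolding loewner_le_iff[OF sym_congruence[OF pos_def_sym[OF H]] pos_def_sym[OF K]]
      by (simp only: inner_congruence)
    moreover have "2 * ?p
        \<le> (B *v ?w) \<bullet> (H *v (B *v ?w)) + u \<bullet> (matrix_inv H *v u)"
      using two_inner_le_quadratic_forms[OF H, of "B *v ?w" u] unfolding p
      by (simp add: inner_commute)
    ultimately show ?thesis by linarith
  qed
  have "sym_matrix (B ** matrix_inv K ** transpose B)"
    using sym_congruence[OF pos_def_sym[OF pos_def_matrix_inv[OF K]], of "transpose B"] by simp
  then show ?thesis
    using form by (simp add: loewner_le_iff pos_def_sym pos_def_matrix_inv H)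
qed

text \<open>The support function of the ellipsoid of \<open>H\<close> at \<open>a\<close> is the square root of
  \<open>a \<bullet> H\<^sup>-\<^sup>1 a\<close>, attained at \<open>H\<^sup>-\<^sup>1 a\<close> divided by that root.\<close>

lemma ellipsoid_in_halfspace_iff:
  assumes H: "pos_def H"
  shows "(\<forall>z. z \<bullet> (H *v z) \<le> 1 \<longrightarrow> a \<bullet> z \<le> 1)
      \<longleftrightarrow> a \<bullet> (matrix_inv H *v a) \<le> 1"
proof (intro iffI allI impI)
  fix z
  assume "a \<bullet> (matrix_inv H *v a) \<le> 1" "z \<bullet> (H *v z) \<le> 1"
  then show "a \<bullet> z \<le> 1"
    using two_inner_le_quadratic_forms[OF H, of z a] by (simp add: inner_commute)
next
  assume in_halfspace: "\<forall>z. z \<bullet> (H *v z) \<le> 1 \<longrightarrow> a \<bullet> z \<le> 1"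
  define q where "q = a \<bullet> (matrix_inv H *v a)"
  have "q \<ge> 0"
    unfolding q_def by (intro pos_def_nonneg pos_def_matrix_inv H)
  show "a \<bullet> (matrix_inv H *v a) \<le> 1"
  proof (cases "q = 0")
    case True
    then show ?thesis by (simp add: q_def)
  next
    case False
    with \<open>q \<ge> 0\<close> have "q > 0" by simp
    define z where "z = (1 / sqrt q) *\<^sub>R (matrix_inv H *v a)"
    have "z \<bullet> (H *v z) = (1 / sqrt q) * (1 / sqrt q) * q"
      by (simp add: z_def matrix_vector_mult_scaleR pos_def_inv_cancel[OF H] q_def inner_commute)
    also have "\<dots> = 1"
      using \<open>q > 0\<close> by (simp add: divide_simps)
    finally have "a \<bullet> z \<le> 1"
      using in_halfspace by simp
    moreover have "a \<bullet> z = q / sqrt q"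
      by (simp add: z_def q_def)
    ultimately have "sqrt q \<le> 1"
      using \<open>q > 0\<close> by (simp add: real_div_sqrt)
    then show ?thesis
      by (simp add: q_def)
  qed
qed

lemma mult_vec_le_1_iff:
  fixes A :: "real^'n^'m"
  shows "A *v z \<le> 1 \<longleftrightarrow> (\<forall>j. row j A \<bullet> z \<le> 1)"
  by (simp add: less_eq_vec_def matrix_vector_mul_component row_def)

lemma ellipsoid_in_polytope_iff:
  fixes A :: "real^'n^'m"
  assumes "pos_def H"
  shows "(\<forall>z. z \<bullet> (H *v z) \<le> 1 \<longrightarrow> A *v z \<le> 1)
      \<longleftrightarrow> (\<forall>j. row j A \<bullet> (matrix_inv H *v row j A) \<le> 1)"
  unfolding mult_vec_le_1_iff ellipsoid_in_halfspace_iff[OF assms, symmetric] by blast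

lemma sum_UNIV_plus_unit:
  fixes f :: "'n::finite + unit \<Rightarrow> real"
  shows "(\<Sum>i\<in>UNIV. f i) = (\<Sum>i\<in>UNIV. f (Inl i)) + f (Inr ())"
  by (simp add: UNIV_Plus_UNIV[symmetric] sum.Plus UNIV_unit del: UNIV_Plus_UNIV)

lemma bordered_form:
  fixes Q :: "real^'n^'n"
  shows "w \<bullet> (bordered Q y *v w) =
    (\<chi> i. w $ Inl i) \<bullet> (Q *v (\<chi> i. w $ Inl i))
      + 2 * w $ Inr () * ((\<chi> i. w $ Inl i) \<bullet> y) + (w $ Inr ())\<^sup>2"
  unfolding bordered_def inner_vec_def matrix_vector_mult_def
  by (simp add: sum_UNIV_plus_unit algebra_simps sum.distrib sum_distrib_left power2_eq_square)

text \<open>The Schur complement criterion.  Minimizing the quadratic form of the bordered matrix over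
  its first block, with last entry \<open>1\<close>, gives \<open>1 - y \<bullet> Q\<^sup>-\<^sup>1 y\<close>, attained at \<open>- Q\<^sup>-\<^sup>1 y\<close>.\<close>

lemma pos_semidef_bordered_iff:
  assumes Q: "pos_def Q"
  shows "pos_semidef (bordered Q y) \<longleftrightarrow> y \<bullet> (matrix_inv Q *v y) \<le> 1"
proof
  assume psd: "pos_semidef (bordered Q y)"
  let ?u = "- (matrix_inv Q *v y)"
  define w :: "real^('a + unit)" where
    "w = (\<chi> i. case i of Inl i' \<Rightarrow> ?u $ i' | Inr _ \<Rightarrow> 1)"
  have "(\<chi> i. w $ Inl i) = ?u" "w $ Inr () = 1"
    by (simp_all add: w_def vec_eq_iff)
  then have "w \<bullet> (bordered Q y *v w) = ?u \<bullet> (Q *v ?u) + 2 * (?u \<bullet> y) + 1"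
    by (simp only: bordered_form) simp
  also have "\<dots> = 1 - y \<bullet> (matrix_inv Q *v y)"
    by (simp add: pos_def_inv_cancel[OF Q] inner_commute
        linear_neg[OF matrix_vector_mul_linear])
  finally show "y \<bullet> (matrix_inv Q *v y) \<le> 1"
    using psd unfolding pos_semidef_def by (metis diff_ge_0_iff_ge)
next
  assume le: "y \<bullet> (matrix_inv Q *v y) \<le> 1"
  have "sym_matrix (bordered Q y)"
    using pos_def_sym[OF Q]
    by (auto simp: sym_matrix_def bordered_def transpose_def vec_eq_iff split: sum.splits)
  moreover have "0 \<le> w \<bullet> (bordered Q y *v w)" for w
  proof -
    define u t where "u = (\<chi> i. w $ Inl i)" and "t = w $ Inr ()"
    have "2 * (u \<bullet> (- t *\<^sub>R y)) \<le> u \<bullet> (Q *v u) + t\<^sup>2 * (y \<bullet> (matrix_inv Q *v y))"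
      using two_inner_le_quadratic_forms[OF Q, of u "- t *\<^sub>R y"]
      by (simp add: matrix_vector_mult_scaleR power2_eq_square mult.assoc del: scaleR_minus_left)
    moreover have "t\<^sup>2 * (y \<bullet> (matrix_inv Q *v y)) \<le> t\<^sup>2 * 1"
      by (intro mult_left_mono le) simp
    ultimately show ?thesis
      unfolding bordered_form u_def[symmetric] t_def[symmetric] by simp
  qed
  ultimately show "pos_semidef (bordered Q y)"
    by (simp add: pos_semidef_def)
qed

section \<open>Equivalence of the two problems\<close>

lemma lyap_family_pos_def:
  "lyap_family s G l H \<Longrightarrow> \<pi> \<in> words s (l - 1) \<Longrightarrow> pos_def (H \<pi>)"
  by (simp add: lyap_family_def)

lemma dual_lyap_family_pos_def:
  "dual_lyap_family s G l Q \<Longrightarrow> \<pi> \<in> words s (l - 1) \<Longrightarrow> pos_def (Q \<pi>)"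
  by (simp add: dual_lyap_family_def)

lemma replicate_in_words: "s \<ge> 1 \<Longrightarrow> replicate k 1 \<in> words s k"
  by (auto simp: words_def)

lemma words_pred:
  assumes "l \<noteq> 1" "l \<ge> 1" "\<sigma> \<in> words s (l - 2)" "i \<in> {1..s}"
  shows "i # \<sigma> \<in> words s (l - 1)" "\<sigma> @ [i] \<in> words s (l - 1)"
  using assms by (auto simp: words_def)

lemma words_0: "words s 0 = {[]}"
  by (auto simp: words_def)

lemma lyap_family_inverse:
  assumes "l \<ge> 1" and fam: "lyap_family s G l H"
  shows "dual_lyap_family s G l (\<lambda>\<pi>. matrix_inv (H \<pi>))"
proof -
  note pd = lyap_family_pos_def[OF fam]
  show ?thesis
  proof (cases "l = 1")
    case True
    then show ?thesis
      using fam pd unfolding lyap_family_def dual_lyap_family_def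
      by (simp add: words_0 pos_def_matrix_inv lyapunov_inverse)
  next
    case False
    then show ?thesis
      using fam pd words_pred[OF False \<open>l \<ge> 1\<close>]
      unfolding lyap_family_def dual_lyap_family_def
      by (simp add: pos_def_matrix_inv lyapunov_inverse)
  qed
qed

text \<open>The dual inequalities are Lyapunov inequalities for the transposed matrices.\<close>

lemma dual_lyap_family_inverse:
  assumes "l \<ge> 1" and fam: "dual_lyap_family s G l Q"
  shows "lyap_family s G l (\<lambda>\<pi>. matrix_inv (Q \<pi>))"
proof -
  note pd = dual_lyap_family_pos_def[OF fam]
  have inverse: "transpose B ** matrix_inv K ** B \<preceq> matrix_inv H"
    if "pos_def H" "pos_def K" "B ** H ** transpose B \<preceq> K" for B H K :: "real^'a^'a"
    using lyapunov_inverse[of H K "transpose B"] that by simp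
  show ?thesis
  proof (cases "l = 1")
    case True
    then show ?thesis
      using fam pd unfolding lyap_family_def dual_lyap_family_def
      by (simp add: words_0 pos_def_matrix_inv inverse)
  next
    case False
    then show ?thesis
      using fam pd words_pred[OF False \<open>l \<ge> 1\<close>]
      unfolding lyap_family_def dual_lyap_family_def
      by (simp add: pos_def_matrix_inv inverse)
  qed
qed

lemma N_feasible_imp_SDP_feasible:
  assumes "s \<ge> 1" "l \<ge> 1" and feas: "N_feasible s G A l r (x, H)"
  shows "SDP_feasible s G A l r (x, \<lambda>\<pi>. matrix_inv (H \<pi>))"
proof -
  have fam: "lyap_family s G l H"
    using feas by (simp add: N_feasible_def)
  note pd = lyap_family_pos_def[OF fam]
  show ?thesis
    using feas lyap_family_inverse[OF \<open>l \<ge> 1\<close> fam]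
      ellipsoid_in_polytope_iff[OF pd[OF replicate_in_words[OF \<open>s \<ge> 1\<close>]], of A]
    unfolding N_feasible_def SDP_feasible_def
    by (simp add: pos_semidef_bordered_iff pos_def_matrix_inv pd matrix_inv_matrix_inv)
qed

lemma SDP_feasible_imp_N_feasible:
  assumes "s \<ge> 1" "l \<ge> 1" and feas: "SDP_feasible s G A l r (x, Q)"
  shows "N_feasible s G A l r (x, \<lambda>\<pi>. matrix_inv (Q \<pi>))"
proof -
  have fam: "dual_lyap_family s G l Q"
    using feas by (simp add: SDP_feasible_def)
  note pd = dual_lyap_family_pos_def[OF fam]
  note pd1 = pd[OF replicate_in_words[OF \<open>s \<ge> 1\<close>]]
  show ?thesis
    using feas dual_lyap_family_inverse[OF \<open>l \<ge> 1\<close> fam]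
      ellipsoid_in_polytope_iff[OF pos_def_matrix_inv[OF pd1], of A,
        unfolded matrix_inv_matrix_inv[OF pd1]]
    unfolding N_feasible_def SDP_feasible_def
    by (simp add: pos_semidef_bordered_iff pd)
qed

section \<open>Optimal values\<close>

lemma opt_value_mono:
  assumes "\<And>v. P v \<Longrightarrow> \<exists>w. Q w \<and> g w \<le> f v"
  shows "opt_value g Q \<le> opt_value f P"
  unfolding opt_value_def by (rule INF_mono) (use assms in force)

lemma opt_value_arg_min:
  assumes "is_arg_min f P v"
  shows "opt_value f P = ereal (f v)"
proof -
  have "(INF w\<in>{w. P w}. ereal (f w)) = ereal (f v)"
    using assms by (intro INF_eqI) (auto simp: is_arg_min_linorder)
  then show ?thesis by (simp add: opt_value_def)
qed

lemma is_arg_min_iff_opt_value: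
  "is_arg_min f P v \<longleftrightarrow> P v \<and> ereal (f v) = opt_value f P"
proof
  assume "is_arg_min f P v"
  then show "P v \<and> ereal (f v) = opt_value f P"
    using opt_value_arg_min[of f P v] by (simp add: is_arg_min_def)
next
  assume v: "P v \<and> ereal (f v) = opt_value f P"
  have "f v \<le> f w" if "P w" for w
  proof -
    have "opt_value f P \<le> ereal (f w)"
      unfolding opt_value_def using that by (intro INF_lower) simp
    then show ?thesis using v by (metis ereal_less_eq(3))
  qed
  with v show "is_arg_min f P v"
    by (simp add: is_arg_min_linorder)
qed

lemma obj_Pair [simp]: "obj c (x, H) = c \<bullet> x"
  by (simp add: obj_def)

lemma opt_value_N_eq_SDP:
  assumes "s \<ge> 1" "l \<ge> 1"
  shows "opt_value (obj c) (N_feasible s G A l r) = opt_value (obj c) (SDP_feasible s G A l r)"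
proof (rule antisym; rule opt_value_mono)
  fix v
  assume "SDP_feasible s G A l r v"
  then show "\<exists>w. N_feasible s G A l r w \<and> obj c w \<le> obj c v"
    using SDP_feasible_imp_N_feasible[OF assms] by (cases v) force
next
  fix v
  assume "N_feasible s G A l r v"
  then show "\<exists>w. SDP_feasible s G A l r w \<and> obj c w \<le> obj c v"
    using N_feasible_imp_SDP_feasible[OF assms] by (cases v) force
qed

lemma arg_min_N_imp_SDP:
  assumes "s \<ge> 1" "l \<ge> 1" "is_arg_min (obj c) (N_feasible s G A l r) (x, H)"
  shows "is_arg_min (obj c) (SDP_feasible s G A l r) (x, \<lambda>\<pi>. matrix_inv (H \<pi>))"
  using assms(3) N_feasible_imp_SDP_feasible[OF assms(1,2)]
  unfolding is_arg_min_iff_opt_value opt_value_N_eq_SDP[OF assms(1,2)] obj_Pair by blast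

lemma arg_min_SDP_imp_N:
  assumes "s \<ge> 1" "l \<ge> 1" "is_arg_min (obj c) (SDP_feasible s G A l r) (x, Q)"
  shows "is_arg_min (obj c) (N_feasible s G A l r) (x, \<lambda>\<pi>. matrix_inv (Q \<pi>))"
  using assms(3) SDP_feasible_imp_N_feasible[OF assms(1,2)]
  unfolding is_arg_min_iff_opt_value opt_value_N_eq_SDP[OF assms(1,2)] obj_Pair by blast

section \<open>Products and the invariant intersection of ellipsoids\<close>

lemma mat_prod_append: "mat_prod (xs @ ys) = mat_prod xs ** mat_prod ys"
  by (induction xs) (simp_all add: mat_prod_def matrix_mul_assoc)

lemma products_0: "products \<G> 0 = {mat 1}"
  by (auto simp: products_def mat_prod_def)

lemma products_SucE:
  assumes "M \<in> products \<G> (Suc k)"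
  obtains B N where "B \<in> \<G>" "N \<in> products \<G> k" "M = B ** N"
proof -
  obtain Ms where Ms: "M = mat_prod Ms" "length Ms = Suc k" "set Ms \<subseteq> \<G>"
    using assms by (auto simp: products_def)
  then obtain B Ns where "Ms = B # Ns"
    by (cases Ms) auto
  with Ms have "B \<in> \<G>" "mat_prod Ns \<in> products \<G> k" "M = B ** mat_prod Ns"
    by (auto simp: products_def mat_prod_def)
  then show ?thesis by (rule that)
qed

lemma products_eq_words:
  "products (G ` {1..s}) k = (\<lambda>\<sigma>. mat_prod (map G \<sigma>)) ` words s k"
proof -
  have "Ms \<in> map G ` words s k" if "length Ms = k" "set Ms \<subseteq> G ` {1..s}" for Ms
  proof -
    have "Ms \<in> map G ` lists {1..s}"
      using that(2) unfolding lists_image[symmetric] by auto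
    then show ?thesis
      using that(1) by (auto simp: words_def in_lists_conv_set)
  qed
  moreover have "length (map G \<sigma>) = k \<and> set (map G \<sigma>) \<subseteq> G ` {1..s}" if "\<sigma> \<in> words s k" for \<sigma>
    using that by (auto simp: words_def)
  ultimately show ?thesis
    unfolding products_def by blast
qed

text \<open>With \<open>V\<^sub>\<pi> y = y \<bullet> H\<^sub>\<pi> y\<close>, the inequality \<open>V\<^sub>i\<^sub>\<sigma> (G\<^sub>j y) \<le> V\<^sub>\<sigma>\<^sub>j y\<close> bounds every \<open>V\<^sub>\<pi>\<close> at \<open>G\<^sub>j y\<close> by
  some member of the family at \<open>y\<close>, whatever \<open>j\<close> is.\<close>

lemma ellipsoids_invariant:
  assumes "l \<ge> 1" and fam: "lyap_family s G l H" and j: "j \<in> {1..s}"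
    and y: "\<forall>\<pi>\<in>words s (l - 1). y \<bullet> (H \<pi> *v y) \<le> 1" and \<pi>: "\<pi> \<in> words s (l - 1)"
  shows "(G j *v y) \<bullet> (H \<pi> *v (G j *v y)) \<le> 1"
proof -
  note pd = lyap_family_pos_def[OF fam]
  obtain \<tau> where \<tau>: "\<tau> \<in> words s (l - 1)" "transpose (G j) ** H \<pi> ** G j \<preceq> H \<tau>"
  proof (cases "l = 1")
    case True
    then show ?thesis
      using that fam j \<pi> by (auto simp: lyap_family_def words_0)
  next
    case False
    then obtain i \<sigma> where "\<pi> = i # \<sigma>" "i \<in> {1..s}" "\<sigma> \<in> words s (l - 2)"
      using \<pi> \<open>l \<ge> 1\<close> by (cases \<pi>) (auto simp: words_def)
    then show ?thesis
      using that[of "\<sigma> @ [j]"] words_pred(2)[OF False \<open>l \<ge> 1\<close> _ j] fam j False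
      by (auto simp: lyap_family_def)
  qed
  have "(G j *v y) \<bullet> (H \<pi> *v (G j *v y)) \<le> y \<bullet> (H \<tau> *v y)"
    using \<tau>(2) pd[OF \<pi>] pd[OF \<tau>(1)]
    by (simp only: loewner_le_iff pos_def_sym sym_congruence inner_congruence)
  with y \<tau>(1) show ?thesis by force
qed

lemma N_feasible_long_products:
  assumes "l \<ge> 1" and feas: "N_feasible s G A l r (x, H)"
    and "r \<le> k" "M \<in> products (G ` {1..s}) k" "\<pi> \<in> words s (l - 1)"
  shows "(M *v x) \<bullet> (H \<pi> *v (M *v x)) \<le> 1"
  using assms(3-)
proof (induction k arbitrary: M \<pi> rule: dec_induct)
  case base
  then show ?case
    using feas by (simp add: N_feasible_def)
next
  case (step k)
  have fam: "lyap_family s G l H"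
    using feas by (simp add: N_feasible_def)
  obtain j N where M: "j \<in> {1..s}" "N \<in> products (G ` {1..s}) k" "M = G j ** N"
    using products_SucE[OF step.prems(1)] by blast
  have "(G j *v (N *v x)) \<bullet> (H \<pi> *v (G j *v (N *v x))) \<le> 1"
    using ellipsoids_invariant[OF \<open>l \<ge> 1\<close> fam M(1) _ step.prems(2)] step.IH[OF M(2)] by blast
  then show ?case
    by (simp add: M(3) matrix_vector_mul_assoc)
qed

lemma N_feasible_product_in_polytope:
  assumes "s \<ge> 1" "l \<ge> 1" and feas: "N_feasible s G A l r (x, H)"
    and M: "M \<in> products (G ` {1..s}) k"
  shows "A *v (M *v x) \<le> 1"
proof (cases "k < r")
  case True
  then show ?thesis
    using feas M by (auto simp: N_feasible_def)
next
  case False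
  then show ?thesis
    using feas N_feasible_long_products[OF \<open>l \<ge> 1\<close> feas _ M replicate_in_words[OF \<open>s \<ge> 1\<close>]]
    by (simp add: N_feasible_def)
qed

lemma N_feasible_imp_RUTVLD_feasible:
  assumes "s \<ge> 1" "l \<ge> 1" "N_feasible s G A l r (x, H)"
  shows "RUTVLD_feasible s G A x"
  using N_feasible_product_in_polytope[OF assms]
  by (auto simp: RUTVLD_feasible_def all_products_def)

lemma N_feasible_mono:
  assumes "s \<ge> 1" "l \<ge> 1" "N_feasible s G A l r (x, H)" "r \<le> k"
  shows "N_feasible s G A l k (x, H)"
  using assms(3) N_feasible_product_in_polytope[OF assms(1-3)]
    N_feasible_long_products[OF assms(2,3,4)]
  by (simp add: N_feasible_def)

section \<open>Uniform decay of products\<close>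

text \<open>Fekete's lemma in multiplicative form; the limit is the infimum \<open>L\<close>.  If the \<open>m\<close>-th root is
  below \<open>t\<close>, splitting \<open>n\<close> into blocks of length \<open>m\<close> gives \<open>a n \<le> K t\<^sup>n\<close> with a constant \<open>K\<close>
  accounting for the remainder block, and the \<open>n\<close>-th root of \<open>K\<close> tends to \<open>1\<close>.  Arguing with roots
  instead of logarithms allows for \<open>a n = 0\<close>.\<close>

lemma fekete_root_convergent:
  fixes a :: "nat \<Rightarrow> real"
  assumes nonneg: "\<And>k. 0 \<le> a k" and submult: "\<And>m n. a (m + n) \<le> a m * a n"
  shows "convergent (\<lambda>k. root k (a k))"
proof -
  define b where "b = (\<lambda>k. root k (a k))"
  define L where "L = Inf (b ` {1..})"
  have b_nonneg: "0 \<le> b k" for k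
    by (simp add: b_def nonneg real_root_ge_zero)
  then have bdd: "bdd_below (b ` {1..})"
    by (intro bdd_belowI2[of _ 0])
  have L_le: "L \<le> b k" if "1 \<le> k" for k
    unfolding L_def using bdd that by (intro cInf_lower) auto
  have "b \<longlonglongrightarrow> L"
  proof (rule order_tendstoI)
    fix y
    assume "y < L"
    then show "\<forall>\<^sub>F n in sequentially. y < b n"
      using L_le by (intro eventually_sequentiallyI[of 1]) force
  next
    fix y
    assume "L < y"
    then obtain t where t: "L < t" "t < y"
      using dense by blast
    obtain m where m: "1 \<le> m" "b m < t"
      using cInf_lessD[of "b ` {1..}" t] t(1) unfolding L_def by auto
    have "t > 0"
      using b_nonneg[of m] m(2) by simp
    have "a m \<le> t ^ m"
    proof -
      have "a m = b m ^ m"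
        using m(1) nonneg by (simp add: b_def)
      then show ?thesis
        using m(2) b_nonneg by (simp add: power_mono)
    qed
    have blocks: "a (q * m + k) \<le> t ^ (q * m) * a k" for q k
    proof (induction q)
      case (Suc q)
      have "a (Suc q * m + k) \<le> a m * a (q * m + k)"
        using submult[of m "q * m + k"] by (simp add: add.assoc)
      also have "\<dots> \<le> t ^ m * (t ^ (q * m) * a k)"
        using Suc \<open>a m \<le> t ^ m\<close> nonneg \<open>t > 0\<close> by (intro mult_mono) auto
      finally show ?case by (simp add: power_add mult.assoc)
    qed simp
    define K where "K = 1 + (\<Sum>k<m. a k / t ^ k)"
    have "K > 0"
      unfolding K_def using nonneg \<open>t > 0\<close> by (intro add_pos_nonneg sum_nonneg) auto
    have a_le: "a n \<le> K * t ^ n" for n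
    proof -
      let ?k = "n mod m"
      have "a ?k / t ^ ?k \<le> (\<Sum>k<m. a k / t ^ k)"
        using m(1) nonneg \<open>t > 0\<close> by (intro member_le_sum) auto
      then have "a ?k \<le> K * t ^ ?k"
        unfolding K_def using \<open>t > 0\<close> by (simp add: pos_divide_le_eq[symmetric])
      then have "t ^ (n div m * m) * a ?k \<le> t ^ (n div m * m) * (K * t ^ ?k)"
        using \<open>t > 0\<close> by (intro mult_left_mono) auto
      also have "\<dots> = K * t ^ (n div m * m + ?k)"
        by (simp only: power_add mult_ac)
      finally show ?thesis
        using blocks[of "n div m" ?k] by simp
    qed
    have "b n \<le> root n K * t" if "1 \<le> n" for n
    proof -
      have "b n \<le> root n (K * t ^ n)"
        unfolding b_def using a_le that by simp
      also have "\<dots> = root n K * t"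
        using that \<open>t > 0\<close> by (simp add: real_root_mult real_root_power_cancel)
      finally show ?thesis .
    qed
    moreover have "(\<lambda>n. root n K * t) \<longlonglongrightarrow> 1 * t"
      by (intro tendsto_mult LIMSEQ_root_const \<open>K > 0\<close> tendsto_const)
    then have "\<forall>\<^sub>F n in sequentially. root n K * t < y"
      by (rule order_tendstoD(2)) (simp add: t)
    ultimately show "\<forall>\<^sub>F n in sequentially. b n < y"
      by (rule_tac eventually_elim2[OF _ eventually_ge_at_top[of 1]]) force+
  qed
  then show ?thesis
    unfolding b_def by (rule convergentI)
qed

definition max_norm :: "nat \<Rightarrow> (nat \<Rightarrow> real^'n^'n) \<Rightarrow> nat \<Rightarrow> real" where
  "max_norm s G k = Max ((\<lambda>\<sigma>. onorm ((*v) (mat_prod (map G \<sigma>)))) ` words s k)"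

lemma finite_words: "finite (words s k)"
  using finite_lists_length_eq[of "{1..s}" k] by (simp add: words_def conj_commute)

lemma onorm_le_max_norm:
  "\<sigma> \<in> words s k \<Longrightarrow> onorm ((*v) (mat_prod (map G \<sigma>))) \<le> max_norm s G k"
  by (simp add: max_norm_def finite_words)

lemma norm_product_le:
  assumes "M \<in> products (G ` {1..s}) k"
  shows "norm (M *v x) \<le> max_norm s G k * norm x"
proof -
  obtain \<sigma> where "\<sigma> \<in> words s k" "M = mat_prod (map G \<sigma>)"
    using assms unfolding products_eq_words by blast
  then have "onorm ((*v) M) \<le> max_norm s G k"
    by (simp add: onorm_le_max_norm)
  then show ?thesis
    using onorm[OF matrix_vector_mul_bounded_linear, of M x]
    by (meson mult_right_mono norm_ge_zero order_trans)
qed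

lemma max_norm_nonneg:
  assumes "s \<ge> 1"
  shows "0 \<le> max_norm s G k"
  using onorm_le_max_norm[OF replicate_in_words[OF assms]]
    onorm_pos_le[OF matrix_vector_mul_bounded_linear] order_trans by blast

lemma max_norm_submult:
  assumes "s \<ge> 1"
  shows "max_norm s G (m + n) \<le> max_norm s G m * max_norm s G n"
proof -
  have "onorm ((*v) (mat_prod (map G \<sigma>))) \<le> max_norm s G m * max_norm s G n"
    if "\<sigma> \<in> words s (m + n)" for \<sigma>
  proof -
    let ?\<sigma>1 = "take m \<sigma>" and ?\<sigma>2 = "drop m \<sigma>"
    have w: "?\<sigma>1 \<in> words s m" "?\<sigma>2 \<in> words s n"
      using that by (auto simp: words_def dest: in_set_takeD in_set_dropD)
    have "mat_prod (map G \<sigma>) = mat_prod (map G ?\<sigma>1) ** mat_prod (map G ?\<sigma>2)"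
      by (metis append_take_drop_id map_append mat_prod_append)
    then have "(*v) (mat_prod (map G \<sigma>)) = (*v) (mat_prod (map G ?\<sigma>1)) \<circ> (*v) (mat_prod (map G ?\<sigma>2))"
      by (simp add: fun_eq_iff matrix_vector_mul_assoc)
    then have "onorm ((*v) (mat_prod (map G \<sigma>)))
        \<le> onorm ((*v) (mat_prod (map G ?\<sigma>1))) * onorm ((*v) (mat_prod (map G ?\<sigma>2)))"
      using onorm_compose[OF matrix_vector_mul_bounded_linear matrix_vector_mul_bounded_linear]
      by metis
    also have "\<dots> \<le> max_norm s G m * max_norm s G n"
      by (intro mult_mono onorm_le_max_norm w max_norm_nonneg assms onorm_pos_le
          matrix_vector_mul_bounded_linear)
    finally show ?thesis .
  qed
  moreover have "words s (m + n) \<noteq> {}"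
    using replicate_in_words[OF assms] by blast
  ultimately show ?thesis
    unfolding max_norm_def[of s G "m + n"] by (simp add: finite_words)
qed

lemma joint_spectral_radius_eq_lim:
  assumes "s \<ge> 1"
  shows "joint_spectral_radius s G = lim (\<lambda>k. root k (max_norm s G k))"
proof -
  have "root k (max_norm s G k)
      = Max ((\<lambda>\<sigma>. root k (onorm ((*v) (mat_prod (map G \<sigma>))))) ` words s k)" for k
  proof -
    have "mono (root k)"
      by (cases "k = 0") (auto intro!: monoI)
    then show ?thesis
      using replicate_in_words[OF assms, of k] unfolding max_norm_def
      by (subst mono_Max_commute) (auto simp: finite_words image_image)
  qed
  then show ?thesis
    by (simp add: joint_spectral_radius_def)
qed

text \<open>Once the defining limit exists and is below some \<open>t < 1\<close>, the maximal norm of the products of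
  length \<open>k\<close> is eventually at most \<open>t\<^sup>k\<close>.\<close>

lemma max_norm_tendsto_0:
  assumes "s \<ge> 1" "joint_spectral_radius s G < 1"
  shows "max_norm s G \<longlonglongrightarrow> 0"
proof -
  let ?b = "\<lambda>k. root k (max_norm s G k)"
  note nonneg = max_norm_nonneg[OF \<open>s \<ge> 1\<close>, of G]
  have "convergent ?b"
    by (intro fekete_root_convergent nonneg max_norm_submult \<open>s \<ge> 1\<close>)
  then have lim: "?b \<longlonglongrightarrow> joint_spectral_radius s G"
    by (simp add: joint_spectral_radius_eq_lim[OF \<open>s \<ge> 1\<close>] convergent_LIMSEQ_iff)
  obtain t where t: "max 0 (joint_spectral_radius s G) < t" "t < 1"
    using dense[of "max 0 (joint_spectral_radius s G)" 1] assms(2) by auto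
  have "\<forall>\<^sub>F k in sequentially. ?b k < t"
    using t(1) by (intro order_tendstoD(2)[OF lim]) simp
  then have "\<forall>\<^sub>F k in sequentially. max_norm s G k \<le> t ^ k"
    using eventually_ge_at_top[of 1]
  proof eventually_elim
    case (elim k)
    then have "max_norm s G k = ?b k ^ k"
      using nonneg by simp
    also have "\<dots> \<le> t ^ k"
      using elim nonneg by (intro power_mono) (auto intro: real_root_ge_zero)
    finally show ?case .
  qed
  moreover have "(\<lambda>k. t ^ k) \<longlonglongrightarrow> 0"
    using t by (intro LIMSEQ_realpow_zero) auto
  ultimately show ?thesis
    using nonneg by (intro tendsto_sandwich[of "\<lambda>_. 0" "max_norm s G" _ "\<lambda>k. t ^ k"]) auto
qed

section \<open>Finite convergence\<close>

lemma pos_def_scaleR: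
  assumes "pos_def H" "\<alpha> > 0"
  shows "pos_def (\<alpha> *\<^sub>R H)"
  using assms
  by (simp add: pos_def_def sym_matrix_def transpose_scalar scaleR_matrix_vector_assoc[symmetric])

lemma lyap_family_scaleR:
  assumes "l \<ge> 1" and fam: "lyap_family s G l H" and "\<alpha> > 0"
  shows "lyap_family s G l (\<lambda>\<pi>. \<alpha> *\<^sub>R H \<pi>)"
proof -
  have scale: "transpose B ** (\<alpha> *\<^sub>R M) ** B \<preceq> \<alpha> *\<^sub>R N"
    if "transpose B ** M ** B \<preceq> N" "pos_def M" "pos_def N" for B M N :: "real^'a^'a"
    using that \<open>\<alpha> > 0\<close>
    by (simp only: loewner_le_iff pos_def_sym pos_def_scaleR sym_congruence inner_congruence)
      (simp add: scaleR_matrix_vector_assoc[symmetric])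
  note pd = lyap_family_pos_def[OF fam]
  show ?thesis
  proof (cases "l = 1")
    case True
    then show ?thesis
      using fam pd \<open>\<alpha> > 0\<close> unfolding lyap_family_def
      by (simp add: words_0 pos_def_scaleR scale)
  next
    case False
    then show ?thesis
      using fam pd words_pred[OF False \<open>l \<ge> 1\<close>] \<open>\<alpha> > 0\<close> unfolding lyap_family_def
      by (simp add: pos_def_scaleR scale)
  qed
qed

text \<open>The ellipsoid of \<open>\<alpha> H\<close> lies in the half-space of \<open>a\<close> once \<open>\<alpha> \<ge> a \<bullet> H\<^sup>-\<^sup>1 a\<close>, so a positive
  number above the sum of these bounds over the rows of \<open>A\<close> serves all half-spaces at once.\<close>

lemma exists_scaling_in_polytope:
  fixes A :: "real^'n^'m"
  assumes H: "pos_def H"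
  obtains \<alpha> where "\<alpha> > 0" "\<forall>z. z \<bullet> ((\<alpha> *\<^sub>R H) *v z) \<le> 1 \<longrightarrow> A *v z \<le> 1"
proof -
  let ?q = "\<lambda>a. a \<bullet> (matrix_inv H *v a)"
  have q_nonneg: "0 \<le> ?q a" for a
    by (intro pos_def_nonneg pos_def_matrix_inv H)
  define \<alpha> where "\<alpha> = 1 + (\<Sum>j\<in>UNIV. ?q (row j A))"
  have "\<alpha> > 0"
    unfolding \<alpha>_def using q_nonneg by (intro add_pos_nonneg sum_nonneg) auto
  moreover have "row j A \<bullet> z \<le> 1" if z: "z \<bullet> ((\<alpha> *\<^sub>R H) *v z) \<le> 1" for j z
  proof -
    have "?q (row j A) \<le> (\<Sum>j\<in>UNIV. ?q (row j A))"
      using q_nonneg by (intro member_le_sum) auto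
    then have "?q (row j A) \<le> \<alpha>"
      by (simp add: \<alpha>_def)
    moreover have "\<alpha> * (z \<bullet> (H *v z)) \<le> 1"
      using z by (simp add: scaleR_matrix_vector_assoc[symmetric])
    \<comment> \<open>Fenchel's inequality at \<open>\<alpha> z\<close> makes both terms on the right at most \<open>\<alpha>\<close>.\<close>
    then have "\<alpha> * (\<alpha> * (z \<bullet> (H *v z))) \<le> \<alpha>"
      using \<open>\<alpha> > 0\<close> by (simp add: mult_left_le)
    ultimately have "2 * (\<alpha> * (row j A \<bullet> z)) \<le> \<alpha> + \<alpha>"
      using two_inner_le_quadratic_forms[OF H, of "\<alpha> *\<^sub>R z" "row j A"]
      by (simp add: matrix_vector_mult_scaleR inner_commute)
    then show ?thesis
      using \<open>\<alpha> > 0\<close> by simp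
  qed
  ultimately show ?thesis
    using that by (simp add: mult_vec_le_1_iff)
qed

lemma RUTVLD_feasible_in_polytope:
  assumes "RUTVLD_feasible s G A x"
  shows "A *v x \<le> 1"
proof -
  have "mat 1 \<in> all_products (G ` {1..s})"
    unfolding all_products_def using products_0 by blast
  then show ?thesis
    using assms unfolding RUTVLD_feasible_def by force
qed

text \<open>The level \<open>r\<close> does not depend on \<open>x\<close>, because the polytope is bounded and the products decay
  uniformly.  Hence the two infima agree at this level, whether or not they are attained.\<close>

lemma finite_convergence:
  fixes A :: "real^'n^'m"
  assumes "s \<ge> 1" "l \<ge> 1" and jsr: "joint_spectral_radius s G < 1"
    and bdd: "bounded {x. A *v x \<le> 1}" and ex: "\<exists>H. lyap_family s G l H"
  obtains r H where "\<And>x. RUTVLD_feasible s G A x \<Longrightarrow> N_feasible s G A l r (x, H)"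
proof -
  obtain H0 where H0: "lyap_family s G l H0"
    using ex by blast
  obtain \<alpha> where \<alpha>: "\<alpha> > 0"
    "\<forall>z. z \<bullet> ((\<alpha> *\<^sub>R H0 (replicate (l - 1) 1)) *v z) \<le> 1 \<longrightarrow> A *v z \<le> 1"
    using exists_scaling_in_polytope[OF lyap_family_pos_def[OF H0 replicate_in_words[OF \<open>s \<ge> 1\<close>]]]
    by blast
  define H where "H = (\<lambda>\<pi>. \<alpha> *\<^sub>R H0 \<pi>)"
  have fam: "lyap_family s G l H"
    unfolding H_def by (rule lyap_family_scaleR[OF \<open>l \<ge> 1\<close> H0 \<alpha>(1)])
  obtain R where R: "\<And>x. A *v x \<le> 1 \<Longrightarrow> norm x \<le> R"
    using bdd by (auto simp: bounded_iff)
  define C where "C = (\<Sum>\<pi>\<in>words s (l - 1). onorm ((*v) (H \<pi>)))"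
  have form_le: "y \<bullet> (H \<pi> *v y) \<le> C * (norm y)\<^sup>2" if "\<pi> \<in> words s (l - 1)" for \<pi> y
  proof -
    have "onorm ((*v) (H \<pi>)) \<le> C"
      unfolding C_def using that
      by (intro member_le_sum) (auto simp: finite_words intro: onorm_pos_le)
    have "y \<bullet> (H \<pi> *v y) \<le> norm y * norm (H \<pi> *v y)"
      by (rule norm_cauchy_schwarz)
    also have "\<dots> \<le> norm y * (onorm ((*v) (H \<pi>)) * norm y)"
      by (intro mult_left_mono onorm) auto
    also have "\<dots> \<le> norm y * (C * norm y)"
      by (intro mult_left_mono mult_right_mono \<open>onorm ((*v) (H \<pi>)) \<le> C\<close>) auto
    finally show ?thesis
      by (simp add: power2_eq_square mult_ac)
  qed
  have "C \<ge> 0"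
    unfolding C_def by (intro sum_nonneg onorm_pos_le matrix_vector_mul_bounded_linear)
  have "(\<lambda>r. C * (max_norm s G r * R)\<^sup>2) \<longlonglongrightarrow> C * (0 * R)\<^sup>2"
    by (intro tendsto_intros max_norm_tendsto_0 \<open>s \<ge> 1\<close> jsr)
  then have "\<forall>\<^sub>F r in sequentially. C * (max_norm s G r * R)\<^sup>2 < 1"
    by (rule order_tendstoD(2)) simp
  then obtain r where r: "C * (max_norm s G r * R)\<^sup>2 < 1"
    by (auto simp: eventually_sequentially)
  have "N_feasible s G A l r (x, H)" if x: "RUTVLD_feasible s G A x" for x
  proof -
    have "(M *v x) \<bullet> (H \<pi> *v (M *v x)) \<le> 1"
      if M: "M \<in> products (G ` {1..s}) r" and \<pi>: "\<pi> \<in> words s (l - 1)" for M \<pi>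
    proof -
      have "norm (M *v x) \<le> max_norm s G r * norm x"
        by (rule norm_product_le[OF M])
      also have "\<dots> \<le> max_norm s G r * R"
        by (intro mult_left_mono R RUTVLD_feasible_in_polytope[OF x] max_norm_nonneg \<open>s \<ge> 1\<close>)
      finally have "C * (norm (M *v x))\<^sup>2 \<le> C * (max_norm s G r * R)\<^sup>2"
        using \<open>C \<ge> 0\<close> by (intro mult_left_mono power_mono) auto
      with form_le[OF \<pi>, of "M *v x"] r show ?thesis by linarith
    qed
    moreover have "A *v (M *v x) \<le> 1" if "M \<in> (\<Union>k<r. products (G ` {1..s}) k)" for M
      using x that by (auto simp: RUTVLD_feasible_def all_products_def)
    ultimately show ?thesis
      using fam \<alpha>(2) unfolding N_feasible_def H_def by blast
  qed
  then show ?thesis by (rule that)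
qed

section \<open>The hierarchy\<close>

lemma RUTVLD_le_SDP:
  assumes "s \<ge> 1" "l \<ge> 1"
  shows "opt_value (\<lambda>x. c \<bullet> x) (RUTVLD_feasible s G A) \<le> opt_value (obj c) (SDP_feasible s G A l r)"
  unfolding opt_value_N_eq_SDP[OF assms, symmetric]
proof (rule opt_value_mono)
  fix v
  assume "N_feasible s G A l r v"
  then show "\<exists>x. RUTVLD_feasible s G A x \<and> c \<bullet> x \<le> obj c v"
    using N_feasible_imp_RUTVLD_feasible[OF assms, of G A r "fst v" "snd v"]
    by (intro exI[of _ "fst v"]) (cases v, simp)
qed

lemma decseq_opt_value_SDP:
  assumes "s \<ge> 1" "l \<ge> 1"
  shows "decseq (\<lambda>r. opt_value (obj c) (SDP_feasible s G A l r))"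
  unfolding opt_value_N_eq_SDP[OF assms, symmetric]
proof (intro decseq_SucI opt_value_mono)
  fix r v
  assume "N_feasible s G A l r v"
  then have "N_feasible s G A l (Suc r) v"
    using N_feasible_mono[OF assms, of G A r _ _ "Suc r"] by (cases v) simp
  then show "\<exists>w. N_feasible s G A l (Suc r) w \<and> obj c w \<le> obj c v"
    by blast
qed

lemma exists_exact_level:
  assumes "s \<ge> 1" "l \<ge> 1" "joint_spectral_radius s G < 1"
    "bounded {x. A *v x \<le> 1}" "\<exists>H. lyap_family s G l H"
  shows "\<exists>r. opt_value (obj c) (SDP_feasible s G A l r)
    = opt_value (\<lambda>x. c \<bullet> x) (RUTVLD_feasible s G A)"
proof -
  obtain r H where "\<And>x. RUTVLD_feasible s G A x \<Longrightarrow> N_feasible s G A l r (x, H)"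
    using finite_convergence[OF assms] by blast
  then have "opt_value (obj c) (N_feasible s G A l r)
      \<le> opt_value (\<lambda>x. c \<bullet> x) (RUTVLD_feasible s G A)"
    by (intro opt_value_mono) force
  then show ?thesis
    using RUTVLD_le_SDP[OF assms(1,2)] opt_value_N_eq_SDP[OF assms(1,2)] by (metis antisym)
qed

lemma arg_min_SDP_imp_RUTVLD:
  assumes "s \<ge> 1" "l \<ge> 1"
    and exact: "opt_value (obj c) (SDP_feasible s G A l r)
      = opt_value (\<lambda>x. c \<bullet> x) (RUTVLD_feasible s G A)"
    and min: "is_arg_min (obj c) (SDP_feasible s G A l r) (x, Q)"
  shows "is_arg_min (\<lambda>x. c \<bullet> x) (RUTVLD_feasible s G A) x"
proof -
  have "SDP_feasible s G A l r (x, Q)"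
    using min by (simp add: is_arg_min_def)
  then have "RUTVLD_feasible s G A x"
    using SDP_feasible_imp_N_feasible[OF assms(1,2)] N_feasible_imp_RUTVLD_feasible[OF assms(1,2)]
    by blast
  then show ?thesis
    using min exact by (simp add: is_arg_min_iff_opt_value)
qed

theorem theorem3p6:
  fixes G :: "nat \<Rightarrow> real^'n^'n" and s l :: nat
    and c :: "real^'n" and A :: "real^'n^'m"
  assumes "s \<ge> 1"
    and "joint_spectral_radius s G < 1"
    and "bounded {x. A *v x \<le> 1}"
    and "l \<ge> 1" and "\<exists>H. lyap_family s G l H"
    and "\<And>l'. 1 \<le> l' \<Longrightarrow> l' < l \<Longrightarrow> \<not> (\<exists>H. lyap_family s G l' H)"
  shows
    "(\<forall>r.
        opt_value (obj c) (N_feasible s G A l r) = opt_value (obj c) (SDP_feasible s G A l r) \<and>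
        {x. \<exists>H. is_arg_min (obj c) (N_feasible s G A l r) (x, H)} =
          {x. \<exists>Q. is_arg_min (obj c) (SDP_feasible s G A l r) (x, Q)} \<and>
        (\<forall>x H. is_arg_min (obj c) (N_feasible s G A l r) (x, H) \<longrightarrow>
           is_arg_min (obj c) (SDP_feasible s G A l r) (x, \<lambda>\<pi>. matrix_inv (H \<pi>))) \<and>
        (\<forall>x Q. is_arg_min (obj c) (SDP_feasible s G A l r) (x, Q) \<longrightarrow>
           is_arg_min (obj c) (N_feasible s G A l r) (x, \<lambda>\<pi>. matrix_inv (Q \<pi>)))) \<and>
     (\<forall>r. opt_value (\<lambda>x. c \<bullet> x) (RUTVLD_feasible s G A)
            \<le> opt_value (obj c) (SDP_feasible s G A l r)) \<and>
     decseq (\<lambda>r. opt_value (obj c) (SDP_feasible s G A l r)) \<and>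
     (\<exists>rbar. opt_value (obj c) (SDP_feasible s G A l rbar)
               = opt_value (\<lambda>x. c \<bullet> x) (RUTVLD_feasible s G A)) \<and>
     (\<forall>rbar. opt_value (obj c) (SDP_feasible s G A l rbar)
               = opt_value (\<lambda>x. c \<bullet> x) (RUTVLD_feasible s G A) \<longrightarrow>
        (\<forall>r\<ge>rbar. opt_value (obj c) (SDP_feasible s G A l r)
               = opt_value (\<lambda>x. c \<bullet> x) (RUTVLD_feasible s G A) \<and>
           (\<forall>x Q. is_arg_min (obj c) (SDP_feasible s G A l r) (x, Q) \<longrightarrow>
              is_arg_min (\<lambda>x. c \<bullet> x) (RUTVLD_feasible s G A) x)))"
proof -
  note sl = \<open>s \<ge> 1\<close> \<open>l \<ge> 1\<close>
  let ?sdp = "\<lambda>r. opt_value (obj c) (SDP_feasible s G A l r)"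
  let ?opt = "opt_value (\<lambda>x. c \<bullet> x) (RUTVLD_feasible s G A)"
  have part_i: "opt_value (obj c) (N_feasible s G A l r) = ?sdp r \<and>
      {x. \<exists>H. is_arg_min (obj c) (N_feasible s G A l r) (x, H)} =
        {x. \<exists>Q. is_arg_min (obj c) (SDP_feasible s G A l r) (x, Q)} \<and>
      (\<forall>x H. is_arg_min (obj c) (N_feasible s G A l r) (x, H) \<longrightarrow>
        is_arg_min (obj c) (SDP_feasible s G A l r) (x, \<lambda>\<pi>. matrix_inv (H \<pi>))) \<and>
      (\<forall>x Q. is_arg_min (obj c) (SDP_feasible s G A l r) (x, Q) \<longrightarrow>
        is_arg_min (obj c) (N_feasible s G A l r) (x, \<lambda>\<pi>. matrix_inv (Q \<pi>)))" for r
  proof (intro conjI allI impI)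
    show "opt_value (obj c) (N_feasible s G A l r) = ?sdp r"
      by (rule opt_value_N_eq_SDP[OF sl])
    show "is_arg_min (obj c) (SDP_feasible s G A l r) (x, \<lambda>\<pi>. matrix_inv (H \<pi>))"
      if "is_arg_min (obj c) (N_feasible s G A l r) (x, H)" for x H
      by (rule arg_min_N_imp_SDP[OF sl that])
    show "is_arg_min (obj c) (N_feasible s G A l r) (x, \<lambda>\<pi>. matrix_inv (Q \<pi>))"
      if "is_arg_min (obj c) (SDP_feasible s G A l r) (x, Q)" for x Q
      by (rule arg_min_SDP_imp_N[OF sl that])
    show "{x. \<exists>H. is_arg_min (obj c) (N_feasible s G A l r) (x, H)} =
        {x. \<exists>Q. is_arg_min (obj c) (SDP_feasible s G A l r) (x, Q)}"
      by (intro Collect_cong iffI; elim exE)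
        (rule exI, erule arg_min_N_imp_SDP[OF sl] arg_min_SDP_imp_N[OF sl])+
  qed
  have exact_above: "?sdp r = ?opt" if "?sdp rbar = ?opt" "r \<ge> rbar" for r rbar
  proof (rule antisym)
    show "?sdp r \<le> ?opt"
      using decseqD[OF decseq_opt_value_SDP[OF sl] that(2), of c G A] that(1) by simp
    show "?opt \<le> ?sdp r"
      by (rule RUTVLD_le_SDP[OF sl])
  qed
  show ?thesis
  proof (intro conjI)
    show "\<exists>rbar. ?sdp rbar = ?opt"
      by (rule exists_exact_level[OF sl assms(2,3,5)])
    show "\<forall>rbar. ?sdp rbar = ?opt \<longrightarrow> (\<forall>r\<ge>rbar. ?sdp r = ?opt \<and>
        (\<forall>x Q. is_arg_min (obj c) (SDP_feasible s G A l r) (x, Q) \<longrightarrow>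
          is_arg_min (\<lambda>x. c \<bullet> x) (RUTVLD_feasible s G A) x))"
      by (intro allI impI conjI) (rule exact_above arg_min_SDP_imp_RUTVLD[OF sl]; assumption?)+
  qed (intro allI part_i RUTVLD_le_SDP[OF sl] decseq_opt_value_SDP[OF sl])+
qed

end
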